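(* Let $(A,+,0)$ and $(B,+,0)$ be partial abelian monoids, regarded as relational monoids, and let $f\colon A\to B$ be a left adjoint in $\mathbf{RelMon}$. Then the monad $\sim\,:=f^{\dagger}\circ f$ on $A$ arising from the adjunction $f\dashv f^{\dagger}$ satisfies the following conditions: \begin{itemize} \item[(C1)] $\sim$ is an equivalence relation on $A$. \item[(C2)] For all $x_1,x_2,y_1,y_2\in A$: if $x_1+y_1$ exists, $x_2+y_2$ exists, $x_1\sim x_2$ and $y_1\sim y_2$, then $x_1+y_1\sim x_2+y_2$. \item[(C5)] For all $x,y,z\in A$: if $x+y$ exists and $(x+y)\sim z$, then there are $x_1,y_1\in A$ such that $x_1\sim x$, $y_1\sim y$, $x_1+y_1$ exists and $x_1+y_1=z$. \end{itemize}
   Context: Relations: a relation $f\colon A\to B$ is a subset $f\subseteq A\times B$; $(a,c)\in g\circ f$ iff there is $b$ with $(a,b)\in f$ and $(b,c)\in g$; $\mathrm{id}_A=\{(a,a):a\in A\}$; $f^{\dagger}=\{(b,a):(a,b)\in f\}$. Mappings are identified with their graphs. A relational monoid is a set $A$ with a subset $E_A\subseteq A$ (the units) and a relation $*\subseteq (A\times A)\times A$, where $(a_1,a_2)\xmapsto{*}a$ means $((a_1,a_2),a)\in *$, such that: (right unit) for each $a\in A$ there is $y\in E_A$ with $(a,y)\xmapsto{*}a$, and whenever $y\in E_A$ and $(a,y)\xmapsto{*}b$ then $a=b$; (left unit) for each $a\in A$ there is $y\in E_A$ with $(y,a)\xmapsto{*}a$, and whenever $y\in E_A$ and $(y,a)\xmapsto{*}b$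 then $a=b$; (associativity) for all $a_1,a_2,a_3,z\in A$, there is $w$ with $(a_1,a_2)\xmapsto{*}w$ and $(w,a_3)\xmapsto{*}z$ if and only if there is $w'$ with $(a_2,a_3)\xmapsto{*}w'$ and $(a_1,w')\xmapsto{*}z$. A morphism of relational monoids $h\colon A\to B$ is a relation $h\subseteq A\times B$ such that (i) whenever $(a_1,a_2)\xmapsto{*}a$ in $A$ and $(a,b)\in h$, there are $b_1,b_2\in B$ with $(a_1,b_1)\in h$, $(a_2,b_2)\in h$ and $(b_1,b_2)\xmapsto{*}b$ in $B$; (ii) whenever $y\in E_A$ and $(y,b)\in h$, then $b\in E_B$. $\mathbf{RelMon}$ is the 2-category with relational monoids as 0-cells, these morphisms as 1-cells, and inclusions of relations as 2-cells. A morphism $f\colon A\to B$ in $\mathbf{RelMon}$ is a left adjoint if there is a morphism $g\colon B\to A$ in $\mathbf{RelMon}$ with $\mathrm{id}_A\subseteq g\circ f$ and $f\circ g\subseteq\mathrm{id}_B$; then $f$ is (the graph of) a mapping and $g=f^{\dagger}$, and one writes $f\dashv f^{\dagger}$. The monad on $A$ arising from this adjunction is the relation $f^{\dagger}\circ f\colon A\to A$. A partial abelian monoid is a set $P$ with an element $0$ and a binary partial operation $+$ (write $a\perp b$ when $a+b$ is defined) such that for all $a,b,c\in P$: (P1) $b\perp c$ and $a\perp b+c$ imply $a\perp b$, $a+b\perp c$ and $a+(b+c)=(a+b)+c$; (P2) $a\perp b$ implies $b\perp a$ and $a+b=b+a$; (P3) $a\perp 0$ and $a+0=a$. It is regarded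 as a relational monoid with $E_P=\{0\}$ and $(a,b)\xmapsto{*}c$ iff $a\perp b$ and $a+b=c$. *)

theory Defs
  imports Main
begin

(* The operation O of the library composes in diagrammatic order. *)
abbreviation rel_after :: "('b \<times> 'c) set \<Rightarrow> ('a \<times> 'b) set \<Rightarrow> ('a \<times> 'c) set"
    (infixr \<open>\<circ>\<^sub>r\<close> 75)
  where "g \<circ>\<^sub>r f \<equiv> f O g"

record 'a relmon =
  rcarrier :: "'a set"
  runits :: "'a set"
  rmult :: "(('a \<times> 'a) \<times> 'a) set"

locale relational_monoid =
  fixes A :: "'a relmon"
  assumes units_subset: "runits A \<subseteq> rcarrier A"
    and mult_subset: "rmult A \<subseteq> (rcarrier A \<times> rcarrier A) \<times> rcarrier A"
    and right_unit_ex: "a \<in> rcarrier A \<Longrightarrow> \<exists>y\<in>runits A. ((a, y), a) \<in> rmult A"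
    and right_unit_eq:
      "\<lbrakk>a \<in> rcarrier A; y \<in> runits A; ((a, y), b) \<in> rmult A\<rbrakk> \<Longrightarrow> a = b"
    and left_unit_ex: "a \<in> rcarrier A \<Longrightarrow> \<exists>y\<in>runits A. ((y, a), a) \<in> rmult A"
    and left_unit_eq:
      "\<lbrakk>a \<in> rcarrier A; y \<in> runits A; ((y, a), b) \<in> rmult A\<rbrakk> \<Longrightarrow> a = b"
    and assoc:
      "\<lbrakk>a1 \<in> rcarrier A; a2 \<in> rcarrier A; a3 \<in> rcarrier A; z \<in> rcarrier A\<rbrakk> \<Longrightarrow>
        (\<exists>w\<in>rcarrier A. ((a1, a2), w) \<in> rmult A \<and> ((w, a3), z) \<in> rmult A) \<longleftrightarrow>
        (\<exists>w'\<in>rcarrier A. ((a2, a3), w') \<in> rmult A \<and> ((a1, w'), z) \<in> rmult A)"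

definition relmon_morphism :: "'a relmon \<Rightarrow> 'b relmon \<Rightarrow> ('a \<times> 'b) set \<Rightarrow> bool"
  where "relmon_morphism A B h \<longleftrightarrow>
    relational_monoid A \<and> relational_monoid B \<and>
    h \<subseteq> rcarrier A \<times> rcarrier B \<and>
    (\<forall>a1 a2 a b. ((a1, a2), a) \<in> rmult A \<and> (a, b) \<in> h \<longrightarrow>
      (\<exists>b1\<in>rcarrier B. \<exists>b2\<in>rcarrier B.
        (a1, b1) \<in> h \<and> (a2, b2) \<in> h \<and> ((b1, b2), b) \<in> rmult B)) \<and>
    (\<forall>y\<in>runits A. \<forall>b. (y, b) \<in> h \<longrightarrow> b \<in> runits B)"

definition relmon_adjunction ::
    "'a relmon \<Rightarrow> 'b relmon \<Rightarrow> ('a \<times> 'b) set \<Rightarrow> ('b \<times> 'a) set \<Rightarrow> bool"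
  where "relmon_adjunction A B f g \<longleftrightarrow>
    relmon_morphism A B f \<and> relmon_morphism B A g \<and>
    Id_on (rcarrier A) \<subseteq> g \<circ>\<^sub>r f \<and> f \<circ>\<^sub>r g \<subseteq> Id_on (rcarrier B)"

definition relmon_left_adjoint :: "'a relmon \<Rightarrow> 'b relmon \<Rightarrow> ('a \<times> 'b) set \<Rightarrow> bool"
  where "relmon_left_adjoint A B f \<longleftrightarrow> (\<exists>g. relmon_adjunction A B f g)"

lemma relmon_adjunction_single_valued:
  assumes "relmon_adjunction A B f g"
  shows "single_valued f" and "Domain f = rcarrier A"
proof -
  have f: "f \<subseteq> rcarrier A \<times> rcarrier B"
    and unit: "\<And>a. a \<in> rcarrier A \<Longrightarrow> (a, a) \<in> f O g"
    and counit: "\<And>b b'. (b, b') \<in> g O f \<Longrightarrow> b = b'"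
    using assms unfolding relmon_adjunction_def relmon_morphism_def by blast+
  show "single_valued f"
  proof (rule single_valuedI)
    fix a b b'
    assume "(a, b) \<in> f" "(a, b') \<in> f"
    moreover from this f have "a \<in> rcarrier A" by blast
    then obtain c where "(a, c) \<in> f" "(c, a) \<in> g" using unit by blast
    ultimately show "b = b'" using counit by blast
  qed
  show "Domain f = rcarrier A" using f unit by blast
qed

lemma relmon_adjunction_right_eq_converse:
  assumes "relmon_adjunction A B f g"
  shows "g = f\<inverse>"
proof -
  have f: "f \<subseteq> rcarrier A \<times> rcarrier B" and g: "g \<subseteq> rcarrier B \<times> rcarrier A"
    and unit: "\<And>a. a \<in> rcarrier A \<Longrightarrow> (a, a) \<in> f O g"
    and counit: "\<And>b b'. (b, b') \<in> g O f \<Longrightarrow> b = b'"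
    using assms unfolding relmon_adjunction_def relmon_morphism_def by blast+
  have "(b, a) \<in> g \<longleftrightarrow> (a, b) \<in> f" for a b
  proof (cases "a \<in> rcarrier A")
    case True
    then obtain c where "(a, c) \<in> f" "(c, a) \<in> g" using unit by blast
    then show ?thesis using counit by blast
  qed (use f g in blast)
  then show ?thesis by auto
qed

definition adjunction_monad :: "('a \<times> 'b) set \<Rightarrow> ('a \<times> 'a) set"
  where "adjunction_monad f = f\<inverse> \<circ>\<^sub>r f"

lemma relmon_adjunction_monad:
  "relmon_adjunction A B f g \<Longrightarrow> g \<circ>\<^sub>r f = adjunction_monad f"
  unfolding adjunction_monad_def by (drule relmon_adjunction_right_eq_converse) simp

(* The partial operation is only meaningful on arguments from the carrier. *)
record 'a pam =
  pcarrier :: "'a set"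
  pzero :: 'a
  pplus :: "'a \<Rightarrow> 'a \<Rightarrow> 'a option"

definition sum_defined :: "'a pam \<Rightarrow> 'a \<Rightarrow> 'a \<Rightarrow> bool"
  where "sum_defined P a b \<longleftrightarrow> pplus P a b \<noteq> None"

(* Unspecified if the sum is undefined. *)
definition psum :: "'a pam \<Rightarrow> 'a \<Rightarrow> 'a \<Rightarrow> 'a"
  where "psum P a b = the (pplus P a b)"

locale partial_abelian_monoid =
  fixes P :: "'a pam"
  assumes zero_closed: "pzero P \<in> pcarrier P"
    and sum_closed:
      "\<lbrakk>a \<in> pcarrier P; b \<in> pcarrier P; sum_defined P a b\<rbrakk> \<Longrightarrow> psum P a b \<in> pcarrier P"
    and P1:
      "\<lbrakk>a \<in> pcarrier P; b \<in> pcarrier P; c \<in> pcarrier P;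
        sum_defined P b c; sum_defined P a (psum P b c)\<rbrakk> \<Longrightarrow>
        sum_defined P a b \<and> sum_defined P (psum P a b) c \<and>
        psum P a (psum P b c) = psum P (psum P a b) c"
    and P2:
      "\<lbrakk>a \<in> pcarrier P; b \<in> pcarrier P; sum_defined P a b\<rbrakk> \<Longrightarrow>
        sum_defined P b a \<and> psum P a b = psum P b a"
    and P3: "a \<in> pcarrier P \<Longrightarrow> sum_defined P a (pzero P) \<and> psum P a (pzero P) = a"

definition relmon_of_pam :: "'a pam \<Rightarrow> 'a relmon"
  where "relmon_of_pam P =
    \<lparr>rcarrier = pcarrier P, runits = {pzero P},
     rmult = {((a, b), c) | a b c. a \<in> pcarrier P \<and> b \<in> pcarrier P \<and> c \<in> pcarrier P \<and>
       sum_defined P a b \<and> psum P a b = c}\<rparr>"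

lemma (in partial_abelian_monoid) relational_monoid_relmon_of_pam:
  "relational_monoid (relmon_of_pam P)"
proof -
  have assoc_right: "sum_defined P a2 a3 \<and> sum_defined P a1 (psum P a2 a3) \<and>
      psum P a1 (psum P a2 a3) = psum P (psum P a1 a2) a3"
    if a: "a1 \<in> pcarrier P" "a2 \<in> pcarrier P" "a3 \<in> pcarrier P"
      and d: "sum_defined P a1 a2" "sum_defined P (psum P a1 a2) a3" for a1 a2 a3
  proof -
    have c: "sum_defined P a2 a1" "psum P a1 a2 = psum P a2 a1"
      "psum P a2 a1 \<in> pcarrier P"
      using P2[OF a(1,2) d(1)] sum_closed[OF a(1,2) d(1)] by simp_all
    have s: "sum_defined P a3 (psum P a2 a1)"
      "psum P (psum P a1 a2) a3 = psum P a3 (psum P a2 a1)"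
      using P2[OF c(3) a(3)] c(2) d(2) by simp_all
    have p: "sum_defined P a3 a2" "sum_defined P (psum P a3 a2) a1"
      "psum P a3 (psum P a2 a1) = psum P (psum P a3 a2) a1"
      using P1[OF a(3,2,1) c(1) s(1)] by simp_all
    have q: "sum_defined P a2 a3" "psum P a3 a2 = psum P a2 a3"
      using P2[OF a(3,2) p(1)] by simp_all
    then show ?thesis
      using P2[OF sum_closed[OF a(3,2) p(1)] a(1) p(2)] p(3) s(2) by simp
  qed
  have P3': "sum_defined P (pzero P) a \<and> psum P (pzero P) a = a"
    if "a \<in> pcarrier P" for a
    using P2[OF that zero_closed] P3[OF that] by simp
  show ?thesis
  proof (rule relational_monoid.intro, goal_cases)
    case (7 a1 a2 a3 z)
    then show ?case
      using assoc_right[of a1 a2 a3] P1[of a1 a2 a3] sum_closed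
      by (auto simp: relmon_of_pam_def)
  qed (simp_all add: relmon_of_pam_def zero_closed P3 P3', auto)
qed

end

theory Submission
  imports Defs
begin

text \<open>
  A left adjoint \<open>f\<close> is the graph of a mapping and its right adjoint is the converse \<open>f\<inverse>\<close>, so the
  monad of the adjunction is the kernel of that mapping, and the kernel of a total mapping is an
  equivalence.  The other two properties say what it means for \<open>f\<close> and for \<open>f\<inverse>\<close>, respectively, to
  be a morphism.  The morphism \<open>f\<close> pushes decompositions forward: if \<open>x * y\<close> contains \<open>a\<close>,
  then \<open>f x * f y\<close> contains \<open>f a\<close>.  When products in the codomain have at most one value, this
  makes the class of \<open>a\<close> depend only on the classes of \<open>x\<close> and \<open>y\<close>.  The morphism \<open>f\<inverse>\<close> lifts
  decompositions: the decomposition \<open>f x * f y\<close> of \<open>f a = f z\<close> lifts along \<open>f\<inverse>\<close> to a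
  decomposition of \<open>z\<close>, whose factors lie in the classes of \<open>x\<close> and \<open>y\<close>.  This last argument
  works in all relational monoids.
\<close>

lemma in_adjunction_monad_iff:
  "(x, y) \<in> adjunction_monad f \<longleftrightarrow> (\<exists>b. (x, b) \<in> f \<and> (y, b) \<in> f)"
  unfolding adjunction_monad_def by blast

lemma equiv_adjunction_monad:
  assumes "relmon_adjunction A B f g"
  shows "equiv (rcarrier A) (adjunction_monad f)"
proof (rule equivI)
  note f = relmon_adjunction_single_valued[OF assms]
  show "adjunction_monad f \<subseteq> rcarrier A \<times> rcarrier A"
    using f(2) unfolding adjunction_monad_def by blast
  show "refl_on (rcarrier A) (adjunction_monad f)"
    using f(2) unfolding refl_on_def in_adjunction_monad_iff by blast
  show "sym (adjunction_monad f)"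
    unfolding sym_def in_adjunction_monad_iff by blast
  show "trans (adjunction_monad f)"
    using f(1) unfolding trans_def single_valued_def in_adjunction_monad_iff by blast
qed

lemma relmon_morphism_mult:
  assumes "relmon_morphism A B h" "((a1, a2), a) \<in> rmult A" "(a, b) \<in> h"
  obtains b1 b2 where "(a1, b1) \<in> h" "(a2, b2) \<in> h" "((b1, b2), b) \<in> rmult B"
  using assms unfolding relmon_morphism_def by blast

text \<open>
  Equivalent factors have the same image, so the images of \<open>a1\<close> and \<open>a2\<close> are values of one and
  the same product in \<open>B\<close>; they coincide as soon as multiplication in \<open>B\<close> is single-valued.
\<close>

lemma adjunction_monad_mult_cong:
  assumes adj: "relmon_adjunction A B f g" and B: "single_valued (rmult B)"
    and mult: "((x1, y1), a1) \<in> rmult A" "((x2, y2), a2) \<in> rmult A"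
    and sim: "(x1, x2) \<in> adjunction_monad f" "(y1, y2) \<in> adjunction_monad f"
  shows "(a1, a2) \<in> adjunction_monad f"
proof -
  have f: "relmon_morphism A B f"
    using adj unfolding relmon_adjunction_def by blast
  note sv = relmon_adjunction_single_valued(1)[OF adj, THEN single_valuedD]
  have image: "\<exists>c. (a, c) \<in> f \<and> ((u, v), c) \<in> rmult B"
    if xy: "((x, y), a) \<in> rmult A" and uv: "(x, u) \<in> f" "(y, v) \<in> f" for x y a u v
  proof -
    have "a \<in> rcarrier A"
      using xy f relational_monoid.mult_subset unfolding relmon_morphism_def by blast
    then obtain c where c: "(a, c) \<in> f"
      using relmon_adjunction_single_valued(2)[OF adj] by blast
    then obtain u' v' where "(x, u') \<in> f" "(y, v') \<in> f" "((u', v'), c) \<in> rmult B"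
      using relmon_morphism_mult[OF f xy c] by blast
    then show ?thesis
      using c sv uv by blast
  qed
  obtain u v where "(x1, u) \<in> f" "(x2, u) \<in> f" "(y1, v) \<in> f" "(y2, v) \<in> f"
    using sim unfolding in_adjunction_monad_iff by blast
  then show ?thesis
    using image[OF mult(1)] image[OF mult(2)] single_valuedD[OF B]
    unfolding in_adjunction_monad_iff by blast
qed

text \<open>
  A decomposition of \<open>a\<close> is pushed forward along \<open>f\<close> and lifted back along the right adjoint,
  this time over \<open>z\<close> instead of \<open>a\<close>.  In other words, the monad is itself a morphism from \<open>A\<close>
  to \<open>A\<close>.
\<close>

lemma adjunction_monad_lift_mult:
  assumes adj: "relmon_adjunction A B f g"
    and mult: "((x, y), a) \<in> rmult A" and sim: "(a, z) \<in> adjunction_monad f"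
  obtains x1 y1 where "(x1, x) \<in> adjunction_monad f" "(y1, y) \<in> adjunction_monad f"
    "((x1, y1), z) \<in> rmult A"
proof -
  have f: "relmon_morphism A B f" and f': "relmon_morphism B A (f\<inverse>)"
    using adj relmon_adjunction_right_eq_converse[OF adj]
    unfolding relmon_adjunction_def by simp_all
  obtain c where c: "(a, c) \<in> f" "(c, z) \<in> f\<inverse>"
    using sim unfolding in_adjunction_monad_iff by blast
  obtain u v where uv: "(x, u) \<in> f" "(y, v) \<in> f" "((u, v), c) \<in> rmult B"
    using relmon_morphism_mult[OF f mult c(1)] .
  obtain x1 y1 where "(u, x1) \<in> f\<inverse>" "(v, y1) \<in> f\<inverse>" "((x1, y1), z) \<in> rmult A"
    using relmon_morphism_mult[OF f' uv(3) c(2)] .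
  then show ?thesis
    using that uv(1,2) unfolding in_adjunction_monad_iff by blast
qed

lemma rcarrier_relmon_of_pam: "rcarrier (relmon_of_pam P) = pcarrier P"
  by (simp add: relmon_of_pam_def)

lemma rmult_relmon_of_pam_iff:
  "((a, b), c) \<in> rmult (relmon_of_pam P) \<longleftrightarrow>
    a \<in> pcarrier P \<and> b \<in> pcarrier P \<and> c \<in> pcarrier P \<and> sum_defined P a b \<and> psum P a b = c"
  by (auto simp: relmon_of_pam_def)

lemma single_valued_rmult_relmon_of_pam: "single_valued (rmult (relmon_of_pam P))"
  by (auto simp: single_valued_def rmult_relmon_of_pam_iff)

theorem proposition5:
  fixes A :: "'a pam" and B :: "'b pam" and f :: "('a \<times> 'b) set"
  assumes "partial_abelian_monoid A"
    and "partial_abelian_monoid B"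
    and "relmon_left_adjoint (relmon_of_pam A) (relmon_of_pam B) f"
  shows "equiv (pcarrier A) (adjunction_monad f)
    \<and> (\<forall>x1\<in>pcarrier A. \<forall>x2\<in>pcarrier A. \<forall>y1\<in>pcarrier A. \<forall>y2\<in>pcarrier A.
        sum_defined A x1 y1 \<longrightarrow> sum_defined A x2 y2 \<longrightarrow>
        (x1, x2) \<in> adjunction_monad f \<longrightarrow> (y1, y2) \<in> adjunction_monad f \<longrightarrow>
        (psum A x1 y1, psum A x2 y2) \<in> adjunction_monad f)
    \<and> (\<forall>x\<in>pcarrier A. \<forall>y\<in>pcarrier A. \<forall>z\<in>pcarrier A.
        sum_defined A x y \<longrightarrow> (psum A x y, z) \<in> adjunction_monad f \<longrightarrow>
        (\<exists>x1\<in>pcarrier A. \<exists>y1\<in>pcarrier A.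
          (x1, x) \<in> adjunction_monad f \<and> (y1, y) \<in> adjunction_monad f \<and>
          sum_defined A x1 y1 \<and> psum A x1 y1 = z))"
proof -
  obtain g where adj: "relmon_adjunction (relmon_of_pam A) (relmon_of_pam B) f g"
    using assms(3) unfolding relmon_left_adjoint_def by blast
  have sum: "((x, y), psum A x y) \<in> rmult (relmon_of_pam A)"
    if "x \<in> pcarrier A" "y \<in> pcarrier A" "sum_defined A x y" for x y
    using that partial_abelian_monoid.sum_closed[OF assms(1)]
    unfolding rmult_relmon_of_pam_iff by blast
  show ?thesis
  proof (intro conjI ballI impI, goal_cases)
    case 1
    show ?case
      using equiv_adjunction_monad[OF adj] unfolding rcarrier_relmon_of_pam .
  next
    case (2 x1 x2 y1 y2)
    then show ?case
      using adjunction_monad_mult_cong[OF adj single_valued_rmult_relmon_of_pam sum sum] by blast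
  next
    case (3 x y z)
    show ?case
      using adjunction_monad_lift_mult[OF adj sum[OF 3(1,2,4)] 3(5)]
      unfolding rmult_relmon_of_pam_iff by blast
  qed
qed

end
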